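(* Let $\mathbf{P}=(P;\wedge_p,\vee_p,\neg_p,\bot_p,\top_p)$ and $\mathbf{Q}=(Q;\wedge_q,\vee_q,\neg_q,\bot_q,\top_q)$ be Boolean algebras, let $A$ be a set, and let $r:A\to P$, $e:P\to A$, $r':A\to Q$, $e':Q\to A$ be maps with $r\circ e=\mathrm{id}_P$ and $r'\circ e'=\mathrm{id}_Q$. Define the algebra $\mathbf{A}=(A;\sqcap,\sqcup,\neg,\lrcorner,e'(\top_q),e(\bot_p))$ by $x\sqcap y:=e(r(x)\wedge_p r(y))$, $x\sqcup y:=e'(r'(x)\vee_q r'(y))$, $\neg x:=e(\neg_p r(x))$, $\lrcorner x:=e'(\neg_q r'(x))$. Then $\mathbf{A}$ is a double Boolean algebra if and only if (1) $e\circ r\circ e'\circ r'=e'\circ r'\circ e\circ r$, and (2) for all $x,y\in A$: $e\big(r(x)\wedge_p r(e'(r'(x)\vee_q r'(y)))\big)=e(r(x))$ and $e'\big(r'(x)\vee_q r'(e(r(x)\wedge_p r(y)))\big)=e'(r'(x))$. Moreover, every double Boolean algebra can be obtained from such a construction.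
   Context: For an algebra $(D;\sqcap,\sqcup,\neg,\lrcorner,\top,\bot)$ of type $(2,2,1,1,0,0)$ write $x\vee y:=\neg(\neg x\sqcap\neg y)$ and $x\wedge y:=\lrcorner(\lrcorner x\sqcup\lrcorner y)$. A double Boolean algebra (dBa) is such an algebra satisfying, for all $x,y,z\in D$: $(x\sqcap x)\sqcap y=x\sqcap y$; $(x\sqcup x)\sqcup y=x\sqcup y$; $x\sqcap y=y\sqcap x$; $x\sqcup y=y\sqcup x$; $\neg(x\sqcap x)=\neg x$; $\lrcorner(x\sqcup x)=\lrcorner x$; $x\sqcap(x\sqcup y)=x\sqcap x$; $x\sqcup(x\sqcap y)=x\sqcup x$; $x\sqcap(y\vee z)=(x\sqcap y)\vee(x\sqcap z)$; $x\sqcup(y\wedge z)=(x\sqcup y)\wedge(x\sqcup z)$; $x\sqcap(x\vee y)=x\sqcap x$; $x\sqcup(x\wedge y)=x\sqcup x$; $\neg\neg(x\sqcap y)=x\sqcap y$; $\lrcorner\lrcorner(x\sqcup y)=x\sqcup y$; $x\sqcap\neg x=\bot$; $x\sqcup\lrcorner x=\top$; $\neg\top=\bot$; $\lrcorner\bot=\top$; $x\sqcap(y\sqcap z)=(x\sqcap y)\sqcap z$; $x\sqcup(y\sqcup z)=(x\sqcup y)\sqcup z$; $\neg\bot=\top\sqcap\top$; $\lrcorner\top=\bot\sqcup\bot$; $(x\sqcap x)\sqcup(x\sqcap x)=(x\sqcup x)\sqcap(x\sqcup x)$. *)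

theory Defs
  imports "HOL-Algebra.Congruence"
begin

text \<open>Algebras have explicit carriers, since the Boolean algebras underlying a given double
  Boolean algebra have to be existentially quantified. Operations are total HOL functions whose
  values matter only on the carrier.\<close>

section \<open>Boolean algebras\<close>

record 'a boolalg = "'a partial_object" +
  bmeet :: "'a \<Rightarrow> 'a \<Rightarrow> 'a" (infixl \<open>\<curlywedge>\<index>\<close> 70)
  bjoin :: "'a \<Rightarrow> 'a \<Rightarrow> 'a" (infixl \<open>\<curlyvee>\<index>\<close> 65)
  bcompl :: "'a \<Rightarrow> 'a"
  bbot :: 'a
  btop :: 'a

text \<open>The one-element algebra is allowed, as in the type class \<^class>\<open>boolean_algebra\<close>.\<close>

locale boolean_algebra_on =
  fixes P :: "('a, 'm) boolalg_scheme" (structure)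
  assumes meet_closed: "\<lbrakk>x \<in> carrier P; y \<in> carrier P\<rbrakk> \<Longrightarrow> x \<curlywedge> y \<in> carrier P"
    and join_closed: "\<lbrakk>x \<in> carrier P; y \<in> carrier P\<rbrakk> \<Longrightarrow> x \<curlyvee> y \<in> carrier P"
    and compl_closed: "x \<in> carrier P \<Longrightarrow> bcompl P x \<in> carrier P"
    and bot_closed: "bbot P \<in> carrier P"
    and top_closed: "btop P \<in> carrier P"
    and meet_assoc: "\<lbrakk>x \<in> carrier P; y \<in> carrier P; z \<in> carrier P\<rbrakk>
      \<Longrightarrow> (x \<curlywedge> y) \<curlywedge> z = x \<curlywedge> (y \<curlywedge> z)"
    and join_assoc: "\<lbrakk>x \<in> carrier P; y \<in> carrier P; z \<in> carrier P\<rbrakk>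
      \<Longrightarrow> (x \<curlyvee> y) \<curlyvee> z = x \<curlyvee> (y \<curlyvee> z)"
    and meet_commute: "\<lbrakk>x \<in> carrier P; y \<in> carrier P\<rbrakk> \<Longrightarrow> x \<curlywedge> y = y \<curlywedge> x"
    and join_commute: "\<lbrakk>x \<in> carrier P; y \<in> carrier P\<rbrakk> \<Longrightarrow> x \<curlyvee> y = y \<curlyvee> x"
    and meet_absorb: "\<lbrakk>x \<in> carrier P; y \<in> carrier P\<rbrakk> \<Longrightarrow> x \<curlywedge> (x \<curlyvee> y) = x"
    and join_absorb: "\<lbrakk>x \<in> carrier P; y \<in> carrier P\<rbrakk> \<Longrightarrow> x \<curlyvee> (x \<curlywedge> y) = x"
    and meet_join_distrib: "\<lbrakk>x \<in> carrier P; y \<in> carrier P; z \<in> carrier P\<rbrakk>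
      \<Longrightarrow> x \<curlywedge> (y \<curlyvee> z) = (x \<curlywedge> y) \<curlyvee> (x \<curlywedge> z)"
    and join_meet_distrib: "\<lbrakk>x \<in> carrier P; y \<in> carrier P; z \<in> carrier P\<rbrakk>
      \<Longrightarrow> x \<curlyvee> (y \<curlywedge> z) = (x \<curlyvee> y) \<curlywedge> (x \<curlyvee> z)"
    and meet_compl: "x \<in> carrier P \<Longrightarrow> x \<curlywedge> bcompl P x = bbot P"
    and join_compl: "x \<in> carrier P \<Longrightarrow> x \<curlyvee> bcompl P x = btop P"


section \<open>Double Boolean algebras\<close>

text \<open>\<open>dneg\<close> is the negation belonging to \<open>\<sqinter>\<close>, and \<open>dopp\<close> the opposition (written with a lower
  right corner in the literature) belonging to \<open>\<squnion>\<close>.\<close>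

record 'a dboolalg = "'a partial_object" +
  dmeet :: "'a \<Rightarrow> 'a \<Rightarrow> 'a" (infixl \<open>\<sqinter>\<index>\<close> 70)
  djoin :: "'a \<Rightarrow> 'a \<Rightarrow> 'a" (infixl \<open>\<squnion>\<index>\<close> 65)
  dneg :: "'a \<Rightarrow> 'a"
  dopp :: "'a \<Rightarrow> 'a"
  dtop :: 'a
  dbot :: 'a

definition dvee :: "('a, 'm) dboolalg_scheme \<Rightarrow> 'a \<Rightarrow> 'a \<Rightarrow> 'a" (infixl \<open>\<curlyvee>\<^sub>d\<index>\<close> 65)
  where "x \<curlyvee>\<^sub>d\<^bsub>D\<^esub> y = dneg D (dneg D x \<sqinter>\<^bsub>D\<^esub> dneg D y)"

definition dwedge :: "('a, 'm) dboolalg_scheme \<Rightarrow> 'a \<Rightarrow> 'a \<Rightarrow> 'a" (infixl \<open>\<curlywedge>\<^sub>d\<index>\<close> 70)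
  where "x \<curlywedge>\<^sub>d\<^bsub>D\<^esub> y = dopp D (dopp D x \<squnion>\<^bsub>D\<^esub> dopp D y)"

locale double_boolean_algebra =
  fixes D :: "('a, 'm) dboolalg_scheme" (structure)
  assumes meet_closed: "\<lbrakk>x \<in> carrier D; y \<in> carrier D\<rbrakk> \<Longrightarrow> x \<sqinter> y \<in> carrier D"
    and join_closed: "\<lbrakk>x \<in> carrier D; y \<in> carrier D\<rbrakk> \<Longrightarrow> x \<squnion> y \<in> carrier D"
    and neg_closed: "x \<in> carrier D \<Longrightarrow> dneg D x \<in> carrier D"
    and opp_closed: "x \<in> carrier D \<Longrightarrow> dopp D x \<in> carrier D"
    and top_closed: "dtop D \<in> carrier D"
    and bot_closed: "dbot D \<in> carrier D"
    and meet_idem_left: "\<lbrakk>x \<in> carrier D; y \<in> carrier D\<rbrakk> \<Longrightarrow> (x \<sqinter> x) \<sqinter> y = x \<sqinter> y"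
    and join_idem_left: "\<lbrakk>x \<in> carrier D; y \<in> carrier D\<rbrakk> \<Longrightarrow> (x \<squnion> x) \<squnion> y = x \<squnion> y"
    and meet_commute: "\<lbrakk>x \<in> carrier D; y \<in> carrier D\<rbrakk> \<Longrightarrow> x \<sqinter> y = y \<sqinter> x"
    and join_commute: "\<lbrakk>x \<in> carrier D; y \<in> carrier D\<rbrakk> \<Longrightarrow> x \<squnion> y = y \<squnion> x"
    and neg_idem: "x \<in> carrier D \<Longrightarrow> dneg D (x \<sqinter> x) = dneg D x"
    and opp_idem: "x \<in> carrier D \<Longrightarrow> dopp D (x \<squnion> x) = dopp D x"
    and meet_join_absorb: "\<lbrakk>x \<in> carrier D; y \<in> carrier D\<rbrakk> \<Longrightarrow> x \<sqinter> (x \<squnion> y) = x \<sqinter> x"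
    and join_meet_absorb: "\<lbrakk>x \<in> carrier D; y \<in> carrier D\<rbrakk> \<Longrightarrow> x \<squnion> (x \<sqinter> y) = x \<squnion> x"
    and meet_vee_distrib: "\<lbrakk>x \<in> carrier D; y \<in> carrier D; z \<in> carrier D\<rbrakk>
      \<Longrightarrow> x \<sqinter> (y \<curlyvee>\<^sub>d z) = (x \<sqinter> y) \<curlyvee>\<^sub>d (x \<sqinter> z)"
    and join_wedge_distrib: "\<lbrakk>x \<in> carrier D; y \<in> carrier D; z \<in> carrier D\<rbrakk>
      \<Longrightarrow> x \<squnion> (y \<curlywedge>\<^sub>d z) = (x \<squnion> y) \<curlywedge>\<^sub>d (x \<squnion> z)"
    and meet_vee_absorb: "\<lbrakk>x \<in> carrier D; y \<in> carrier D\<rbrakk> \<Longrightarrow> x \<sqinter> (x \<curlyvee>\<^sub>d y) = x \<sqinter> x"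
    and join_wedge_absorb: "\<lbrakk>x \<in> carrier D; y \<in> carrier D\<rbrakk> \<Longrightarrow> x \<squnion> (x \<curlywedge>\<^sub>d y) = x \<squnion> x"
    and neg_neg_meet: "\<lbrakk>x \<in> carrier D; y \<in> carrier D\<rbrakk> \<Longrightarrow> dneg D (dneg D (x \<sqinter> y)) = x \<sqinter> y"
    and opp_opp_join: "\<lbrakk>x \<in> carrier D; y \<in> carrier D\<rbrakk> \<Longrightarrow> dopp D (dopp D (x \<squnion> y)) = x \<squnion> y"
    and meet_neg: "x \<in> carrier D \<Longrightarrow> x \<sqinter> dneg D x = dbot D"
    and join_opp: "x \<in> carrier D \<Longrightarrow> x \<squnion> dopp D x = dtop D"
    and neg_top: "dneg D (dtop D) = dbot D"
    and opp_bot: "dopp D (dbot D) = dtop D"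
    and meet_assoc: "\<lbrakk>x \<in> carrier D; y \<in> carrier D; z \<in> carrier D\<rbrakk>
      \<Longrightarrow> x \<sqinter> (y \<sqinter> z) = (x \<sqinter> y) \<sqinter> z"
    and join_assoc: "\<lbrakk>x \<in> carrier D; y \<in> carrier D; z \<in> carrier D\<rbrakk>
      \<Longrightarrow> x \<squnion> (y \<squnion> z) = (x \<squnion> y) \<squnion> z"
    and neg_bot: "dneg D (dbot D) = dtop D \<sqinter> dtop D"
    and opp_top: "dopp D (dtop D) = dbot D \<squnion> dbot D"
    and meet_join_idem: "x \<in> carrier D \<Longrightarrow> (x \<sqinter> x) \<squnion> (x \<sqinter> x) = (x \<squnion> x) \<sqinter> (x \<squnion> x)"


section \<open>The construction from two Boolean algebras\<close>

definition retraction_data ::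
  "'p boolalg \<Rightarrow> 'q boolalg \<Rightarrow> 'a set \<Rightarrow>
   ('a \<Rightarrow> 'p) \<Rightarrow> ('p \<Rightarrow> 'a) \<Rightarrow> ('a \<Rightarrow> 'q) \<Rightarrow> ('q \<Rightarrow> 'a) \<Rightarrow> bool"
  where "retraction_data P Q A r e r' e' \<longleftrightarrow>
    boolean_algebra_on P \<and> boolean_algebra_on Q \<and>
    r \<in> A \<rightarrow> carrier P \<and> e \<in> carrier P \<rightarrow> A \<and> (\<forall>p \<in> carrier P. r (e p) = p) \<and>
    r' \<in> A \<rightarrow> carrier Q \<and> e' \<in> carrier Q \<rightarrow> A \<and> (\<forall>q \<in> carrier Q. r' (e' q) = q)"

definition dba_construction ::
  "'p boolalg \<Rightarrow> 'q boolalg \<Rightarrow> 'a set \<Rightarrow>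
   ('a \<Rightarrow> 'p) \<Rightarrow> ('p \<Rightarrow> 'a) \<Rightarrow> ('a \<Rightarrow> 'q) \<Rightarrow> ('q \<Rightarrow> 'a) \<Rightarrow> 'a dboolalg"
  where "dba_construction P Q A r e r' e' =
    \<lparr>carrier = A,
     dmeet = (\<lambda>x y. e (r x \<curlywedge>\<^bsub>P\<^esub> r y)),
     djoin = (\<lambda>x y. e' (r' x \<curlyvee>\<^bsub>Q\<^esub> r' y)),
     dneg = (\<lambda>x. e (bcompl P (r x))),
     dopp = (\<lambda>x. e' (bcompl Q (r' x))),
     dtop = e' (btop Q),
     dbot = e (bbot P)\<rparr>"

text \<open>Equality of algebras. Plain record equality would also compare the irrelevant values of the
  operations outside the carrier.\<close>

definition same_dboolalg :: "'a dboolalg \<Rightarrow> 'a dboolalg \<Rightarrow> bool"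
  where "same_dboolalg D E \<longleftrightarrow>
    carrier D = carrier E \<and>
    (\<forall>x \<in> carrier D. \<forall>y \<in> carrier D. x \<sqinter>\<^bsub>D\<^esub> y = x \<sqinter>\<^bsub>E\<^esub> y) \<and>
    (\<forall>x \<in> carrier D. \<forall>y \<in> carrier D. x \<squnion>\<^bsub>D\<^esub> y = x \<squnion>\<^bsub>E\<^esub> y) \<and>
    (\<forall>x \<in> carrier D. dneg D x = dneg E x) \<and>
    (\<forall>x \<in> carrier D. dopp D x = dopp E x) \<and>
    dtop D = dtop E \<and> dbot D = dbot E"

definition commuting_condition ::
  "'a set \<Rightarrow> ('a \<Rightarrow> 'p) \<Rightarrow> ('p \<Rightarrow> 'a) \<Rightarrow> ('a \<Rightarrow> 'q) \<Rightarrow> ('q \<Rightarrow> 'a) \<Rightarrow> bool"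
  where "commuting_condition A r e r' e' \<longleftrightarrow>
    (\<forall>x \<in> A. (e \<circ> r \<circ> e' \<circ> r') x = (e' \<circ> r' \<circ> e \<circ> r) x)"

definition absorption_condition ::
  "'p boolalg \<Rightarrow> 'q boolalg \<Rightarrow> 'a set \<Rightarrow>
   ('a \<Rightarrow> 'p) \<Rightarrow> ('p \<Rightarrow> 'a) \<Rightarrow> ('a \<Rightarrow> 'q) \<Rightarrow> ('q \<Rightarrow> 'a) \<Rightarrow> bool"
  where "absorption_condition P Q A r e r' e' \<longleftrightarrow>
    (\<forall>x \<in> A. \<forall>y \<in> A.
       e (r x \<curlywedge>\<^bsub>P\<^esub> r (e' (r' x \<curlyvee>\<^bsub>Q\<^esub> r' y))) = e (r x) \<and>
       e' (r' x \<curlyvee>\<^bsub>Q\<^esub> r' (e (r x \<curlywedge>\<^bsub>P\<^esub> r y))) = e' (r' x))"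

end

theory Submission
  imports Defs
begin

(* Through r and r' every axiom becomes a Boolean identity in P or in Q, except for
   meet_join_idem, which is condition (1), the two mixed absorption laws, which are condition (2),
   and the laws on the constants. The latter follow from (2), which forces r to send the top
   e' (btop Q) to btop P and, dually, r' to send the bottom e (bbot P) to bbot Q.
   Conversely, in a double Boolean algebra the idempotents of either operation form a Boolean
   algebra. Take these two as P and Q, r x and r' x as the squares of x, and inclusions as e, e':
   the operations do not distinguish x from its square, so they are recovered. *)

section \<open>Boolean algebra laws derived from the axioms with explicit carriers\<close>

context boolean_algebra_on
begin

text \<open>Both absorption laws combine: \<open>join_absorb\<close> gives x = x \<curlyvee> (x
  \<curlywedge> x), and meeting x with the right-hand side gives x by
  \<open>meet_absorb\<close>.\<close>

lemma meet_idem: "x \<in> carrier P \<Longrightarrow> x \<curlywedge> x = x"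
  by (metis join_absorb meet_absorb meet_closed)

lemma join_idem: "x \<in> carrier P \<Longrightarrow> x \<curlyvee> x = x"
  by (metis join_absorb meet_idem)

lemma meet_left_commute:
  "\<lbrakk>x \<in> carrier P; y \<in> carrier P; z \<in> carrier P\<rbrakk> \<Longrightarrow> x \<curlywedge> (y \<curlywedge> z) = y \<curlywedge> (x \<curlywedge> z)"
  by (metis meet_assoc meet_commute)

lemma join_left_commute:
  "\<lbrakk>x \<in> carrier P; y \<in> carrier P; z \<in> carrier P\<rbrakk> \<Longrightarrow> x \<curlyvee> (y \<curlyvee> z) = y \<curlyvee> (x \<curlyvee> z)"
  by (metis join_assoc join_commute)

text \<open>The axioms contain no unit laws. Writing the bottom as the meet of x with its own
  complement, associativity and idempotence absorb the extra x; the unit laws below then follow by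
  absorption.\<close>

lemma meet_bot:
  assumes "x \<in> carrier P"
  shows "x \<curlywedge> bbot P = bbot P"
  using assms by (metis meet_assoc meet_compl meet_idem compl_closed)

lemma join_top:
  assumes "x \<in> carrier P"
  shows "x \<curlyvee> btop P = btop P"
  using assms by (metis join_assoc join_compl join_idem compl_closed)

lemma join_bot: "x \<in> carrier P \<Longrightarrow> x \<curlyvee> bbot P = x"
  by (metis join_absorb meet_bot bot_closed)

lemma meet_top: "x \<in> carrier P \<Longrightarrow> x \<curlywedge> btop P = x"
  by (metis meet_absorb join_top top_closed)

text \<open>Distributing over x \<curlyvee> y on one side and over the join of x with
  \<open>bcompl P x\<close> on the other shows that both complements equal \<open>bcompl P x\<close>
  \<curlywedge> y.\<close>

lemma compl_unique:
  assumes x: "x \<in> carrier P" and y: "y \<in> carrier P"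
    and meet: "x \<curlywedge> y = bbot P" and join: "x \<curlyvee> y = btop P"
  shows "bcompl P x = y"
proof -
  note c = compl_closed[OF x]
  have "bcompl P x = bcompl P x \<curlywedge> (x \<curlyvee> y)"
    using c join by (simp add: meet_top)
  also have "\<dots> = bcompl P x \<curlywedge> y"
    using x y c by (metis meet_join_distrib meet_compl meet_commute join_bot join_commute
        meet_closed bot_closed)
  also have "\<dots> = y \<curlywedge> (x \<curlyvee> bcompl P x)"
    using x y c meet by (metis meet_join_distrib meet_commute join_bot join_commute
        meet_closed bot_closed)
  also have "\<dots> = y"
    using x y by (simp add: join_compl meet_top)
  finally show ?thesis .
qed

lemma compl_compl: "x \<in> carrier P \<Longrightarrow> bcompl P (bcompl P x) = x"
  by (metis compl_unique compl_closed meet_compl join_compl meet_commute join_commute)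

lemma compl_bot: "bcompl P (bbot P) = btop P"
  by (metis compl_unique bot_closed top_closed meet_top join_top meet_commute join_commute)

lemma compl_top: "bcompl P (btop P) = bbot P"
  by (metis compl_bot compl_compl bot_closed)

text \<open>By uniqueness of complements it suffices to check that the right-hand side complements x
  \<curlywedge> y; distributivity reduces this to x and y separately.\<close>

lemma compl_meet:
  assumes x: "x \<in> carrier P" and y: "y \<in> carrier P"
  shows "bcompl P (x \<curlywedge> y) = bcompl P x \<curlyvee> bcompl P y"
proof (rule compl_unique)
  let ?x = "bcompl P x" and ?y = "bcompl P y"
  note c = x y compl_closed[OF x] compl_closed[OF y]
  have "(x \<curlywedge> y) \<curlywedge> ?x = bbot P"
    using c by (metis meet_assoc meet_commute meet_compl meet_bot)
  moreover have "(x \<curlywedge> y) \<curlywedge> ?y = bbot P"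
    using c by (simp add: meet_assoc meet_compl meet_bot)
  ultimately show "(x \<curlywedge> y) \<curlywedge> (?x \<curlyvee> ?y) = bbot P"
    using c by (simp add: meet_join_distrib meet_closed join_bot bot_closed)
  have "x \<curlyvee> (?x \<curlyvee> ?y) = btop P"
    using c by (metis join_assoc join_commute join_compl join_top)
  moreover have "y \<curlyvee> (?x \<curlyvee> ?y) = btop P"
    using c by (metis join_assoc join_commute join_compl join_top)
  ultimately show "(x \<curlywedge> y) \<curlyvee> (?x \<curlyvee> ?y) = btop P"
    using c by (metis join_meet_distrib join_closed join_commute meet_closed meet_top top_closed)
qed (use x y in \<open>simp_all add: meet_closed join_closed compl_closed\<close>)

lemma compl_join:
  assumes "x \<in> carrier P" "y \<in> carrier P"
  shows "bcompl P (x \<curlyvee> y) = bcompl P x \<curlywedge> bcompl P y"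
  using assms by (metis compl_meet compl_compl compl_closed meet_closed)

lemmas closed = meet_closed join_closed compl_closed bot_closed top_closed

end

section \<open>When the construction yields a double Boolean algebra\<close>

theorem double_boolean_algebra_construction_iff:
  fixes P :: "'p boolalg" and Q :: "'q boolalg"
  assumes data: "retraction_data P Q A r e r' e'"
  shows "double_boolean_algebra (dba_construction P Q A r e r' e') \<longleftrightarrow>
    commuting_condition A r e r' e' \<and> absorption_condition P Q A r e r' e'"
    (is "?L \<longleftrightarrow> ?C \<and> ?S")
proof -
  interpret P: boolean_algebra_on P using data by (simp add: retraction_data_def)
  interpret Q: boolean_algebra_on Q using data by (simp add: retraction_data_def)
  have r [simp]: "\<And>x. x \<in> A \<Longrightarrow> r x \<in> carrier P" and e [simp]: "\<And>p. p \<in> carrier P \<Longrightarrow> e p \<in> A"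
    and re [simp]: "\<And>p. p \<in> carrier P \<Longrightarrow> r (e p) = p"
    and r' [simp]: "\<And>x. x \<in> A \<Longrightarrow> r' x \<in> carrier Q" and e' [simp]: "\<And>q. q \<in> carrier Q \<Longrightarrow> e' q \<in> A"
    and re' [simp]: "\<And>q. q \<in> carrier Q \<Longrightarrow> r' (e' q) = q"
    using data by (auto simp: retraction_data_def)
  note closed [simp] = P.closed Q.closed
  let ?D = "dba_construction P Q A r e r' e'"
  have ops [simp]: "carrier ?D = A"
    "\<And>x y. x \<sqinter>\<^bsub>?D\<^esub> y = e (r x \<curlywedge>\<^bsub>P\<^esub> r y)" "\<And>x y. x \<squnion>\<^bsub>?D\<^esub> y = e' (r' x \<curlyvee>\<^bsub>Q\<^esub> r' y)"
    "\<And>x. dneg ?D x = e (bcompl P (r x))" "\<And>x. dopp ?D x = e' (bcompl Q (r' x))"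
    "dtop ?D = e' (btop Q)" "dbot ?D = e (bbot P)"
    by (simp_all add: dba_construction_def)
  \<comment> \<open>De Morgan in P identifies the derived join with the join of P, so the laws about
    it become distributivity and absorption in P.\<close>
  have vee [simp]: "x \<curlyvee>\<^sub>d\<^bsub>?D\<^esub> y = e (r x \<curlyvee>\<^bsub>P\<^esub> r y)" if "x \<in> A" "y \<in> A" for x y
    using that by (simp add: dvee_def P.compl_meet P.compl_compl)
  have wedge [simp]: "x \<curlywedge>\<^sub>d\<^bsub>?D\<^esub> y = e' (r' x \<curlywedge>\<^bsub>Q\<^esub> r' y)" if "x \<in> A" "y \<in> A" for x y
    using that by (simp add: dwedge_def Q.compl_join Q.compl_compl)
  note idem [simp] = P.meet_idem Q.join_idem
  show ?thesis
  proof
    assume ?L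
    then interpret D: double_boolean_algebra ?D .
    \<comment> \<open>Since squares collapse to \<open>e (r x)\<close> and \<open>e' (r' x)\<close>,
      the two sides of \<open>meet_join_idem\<close> are exactly the two composites.\<close>
    have ?C
      using D.meet_join_idem by (simp add: commuting_condition_def)
    moreover have ?S
      using D.meet_join_absorb D.join_meet_absorb by (simp add: absorption_condition_def)
    ultimately show "?C \<and> ?S" ..
  next
    assume "?C \<and> ?S"
    then have comm: "\<And>x. x \<in> A \<Longrightarrow> e (r (e' (r' x))) = e' (r' (e (r x)))"
      and abs: "\<And>x y. \<lbrakk>x \<in> A; y \<in> A\<rbrakk> \<Longrightarrow> e (r x \<curlywedge>\<^bsub>P\<^esub> r (e' (r' x \<curlyvee>\<^bsub>Q\<^esub> r' y))) = e (r x)"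
      and abs': "\<And>x y. \<lbrakk>x \<in> A; y \<in> A\<rbrakk> \<Longrightarrow> e' (r' x \<curlyvee>\<^bsub>Q\<^esub> r' (e (r x \<curlywedge>\<^bsub>P\<^esub> r y))) = e' (r' x)"
      by (simp_all add: commuting_condition_def absorption_condition_def)
    \<comment> \<open>At these arguments the inner join is \<open>btop Q\<close>; applying
      \<open>r\<close> cancels the outer \<open>e\<close>, and what remains says that
      \<open>r (e' (btop Q))\<close> lies above \<open>btop P\<close>.\<close>
    have "btop P \<curlywedge>\<^bsub>P\<^esub> r (e' (btop Q)) = btop P"
      using arg_cong[OF abs[of "e (btop P)" "e' (btop Q)"], of r] by (simp add: Q.join_top)
    then have top [simp]: "r (e' (btop Q)) = btop P"
      by (metis P.meet_commute P.meet_top P.top_closed Q.top_closed e' r)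
    have "bbot Q \<curlyvee>\<^bsub>Q\<^esub> r' (e (bbot P)) = bbot Q"
      using arg_cong[OF abs'[of "e' (bbot Q)" "e (bbot P)"], of r'] by (simp add: P.meet_bot)
    then have bot [simp]: "r' (e (bbot P)) = bbot Q"
      by (metis Q.join_commute Q.join_bot Q.bot_closed P.bot_closed e r')
    show ?L
      by unfold_locales
        (simp_all add: P.meet_assoc Q.join_assoc P.meet_commute Q.join_commute
          P.meet_left_commute Q.join_left_commute P.compl_compl Q.compl_compl P.meet_join_distrib
          Q.join_meet_distrib P.meet_absorb Q.join_absorb P.join_absorb Q.meet_absorb
          P.meet_compl Q.join_compl P.compl_bot P.compl_top Q.compl_bot Q.compl_top
          comm abs abs')
  qed
qed

section \<open>Order duality for both kinds of algebra\<close>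

definition dual_boolalg :: "'a boolalg \<Rightarrow> 'a boolalg"
  where "dual_boolalg B = \<lparr>carrier = carrier B, bmeet = bjoin B, bjoin = bmeet B,
    bcompl = bcompl B, bbot = btop B, btop = bbot B\<rparr>"

lemma boolean_algebra_on_dual:
  assumes "boolean_algebra_on B"
  shows "boolean_algebra_on (dual_boolalg B)"
proof -
  interpret boolean_algebra_on B by (fact assms)
  show ?thesis
    unfolding dual_boolalg_def
    by unfold_locales
      \<comment> \<open>Commutativity and distributivity are left to single rule applications, as
        the two distributive laws used together for rewriting can feed each other endlessly.\<close>
      (simp_all add: closed meet_assoc join_assoc meet_absorb join_absorb meet_compl join_compl,
        (rule meet_commute join_commute meet_join_distrib join_meet_distrib; assumption)+)
qed

definition dual_dboolalg :: "'a dboolalg \<Rightarrow> 'a dboolalg"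
  where "dual_dboolalg D = \<lparr>carrier = carrier D, dmeet = djoin D, djoin = dmeet D,
    dneg = dopp D, dopp = dneg D, dtop = dbot D, dbot = dtop D\<rparr>"

lemma dual_dboolalg_sel [simp]:
  "carrier (dual_dboolalg D) = carrier D"
  "dmeet (dual_dboolalg D) = djoin D" "djoin (dual_dboolalg D) = dmeet D"
  "dneg (dual_dboolalg D) = dopp D" "dopp (dual_dboolalg D) = dneg D"
  "dtop (dual_dboolalg D) = dbot D" "dbot (dual_dboolalg D) = dtop D"
  "dvee (dual_dboolalg D) = dwedge D" "dwedge (dual_dboolalg D) = dvee D"
  by (simp_all add: dual_dboolalg_def dvee_def dwedge_def fun_eq_iff)

text \<open>The axioms come in dual pairs, and \<open>meet_join_idem\<close> is dual to itself with
  its sides exchanged. Facts about meet therefore transfer to join.\<close>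

lemma double_boolean_algebra_dual:
  assumes "double_boolean_algebra D"
  shows "double_boolean_algebra (dual_dboolalg D)"
proof -
  interpret double_boolean_algebra D by (fact assms)
  show ?thesis
    by unfold_locales
      (simp_all only: dual_dboolalg_sel meet_closed join_closed neg_closed opp_closed top_closed
        bot_closed meet_idem_left join_idem_left neg_idem opp_idem meet_join_absorb
        join_meet_absorb meet_vee_absorb join_wedge_absorb
        neg_neg_meet opp_opp_join meet_neg join_opp neg_top opp_bot meet_assoc join_assoc neg_bot
        opp_top meet_join_idem, simp_all only: meet_vee_distrib join_wedge_distrib,
        simp_all only: meet_commute join_commute)
qed

section \<open>The Boolean algebra of meet-idempotents\<close>

definition meet_idempotents :: "'a dboolalg \<Rightarrow> 'a boolalg"
  where "meet_idempotents D = \<lparr>carrier = {x \<in> carrier D. x \<sqinter>\<^bsub>D\<^esub> x = x}, bmeet = dmeet D,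
    bjoin = dvee D, bcompl = dneg D, bbot = dbot D, btop = dtop D \<sqinter>\<^bsub>D\<^esub> dtop D\<rparr>"

context
  fixes D :: "'a dboolalg" (structure)
  assumes D: "double_boolean_algebra D"
begin

interpretation double_boolean_algebra D by (fact D)

text \<open>The four factors regroup as the squares of x and y, and \<open>meet_idem_left\<close>
  removes each repetition. Hence all meets are idempotent.\<close>

lemma meet_meet_idem:
  assumes "x \<in> carrier D" "y \<in> carrier D"
  shows "(x \<sqinter> y) \<sqinter> (x \<sqinter> y) = x \<sqinter> y"
  using assms by (metis meet_closed meet_assoc meet_commute meet_idem_left)

text \<open>Negation does not distinguish x from its square, and double negation fixes the square
  because it is a meet.\<close>

lemma neg_neg:
  assumes "x \<in> carrier D"
  shows "dneg D (dneg D x) = x \<sqinter> x"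
  using assms by (metis neg_idem neg_neg_meet)

(* The negation of the square of dneg D x is the double negation of x, that is, the square of x;
   negating once more gives both dneg D x and its square. *)
lemma neg_meet_idem:
  assumes "x \<in> carrier D"
  shows "dneg D x \<sqinter> dneg D x = dneg D x"
  using assms by (metis neg_idem neg_neg neg_closed)

text \<open>On idempotents, negation is an involution exchanging meet and derived join. The axioms
  supply the laws with meet outermost; distributivity and absorption with join outermost follow by
  negating both sides and cancelling with \<open>inj\<close>.\<close>

lemma boolean_algebra_on_meet_idempotents: "boolean_algebra_on (meet_idempotents D)"
proof -
  define S where "S = {x \<in> carrier D. x \<sqinter> x = x}"
  have S: "x \<in> carrier D" "x \<sqinter> x = x" if "x \<in> S" for x
    using that by (simp_all add: S_def)
  have neg: "dneg D x \<in> S" if "x \<in> S" for x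
    using S[OF that] by (simp add: S_def neg_closed neg_meet_idem)
  have meet: "x \<sqinter> y \<in> S" if "x \<in> S" "y \<in> S" for x y
    using S(1)[OF that(1)] S(1)[OF that(2)] by (simp add: S_def meet_closed meet_meet_idem)
  have vee: "x \<curlyvee>\<^sub>d y \<in> S" if "x \<in> S" "y \<in> S" for x y
    using that by (simp add: dvee_def neg meet)
  have nn: "dneg D (dneg D x) = x" if "x \<in> S" for x
    using S[OF that] by (simp add: neg_neg)
  have neg_vee: "dneg D (x \<curlyvee>\<^sub>d y) = dneg D x \<sqinter> dneg D y" if "x \<in> S" "y \<in> S" for x y
    using that by (simp add: dvee_def neg meet nn)
  have neg_meet: "dneg D (x \<sqinter> y) = dneg D x \<curlyvee>\<^sub>d dneg D y" if "x \<in> S" "y \<in> S" for x y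
    using that by (simp add: dvee_def neg meet nn)
  have inj: "x = y" if "dneg D x = dneg D y" "x \<in> S" "y \<in> S" for x y
    using that by (metis nn)
  \<comment> \<open>The bottom is a meet, namely of \<open>dtop D\<close> with its negation, hence
    idempotent.\<close>
  have bot: "dbot D \<in> S"
    using meet_neg[OF top_closed] meet_meet_idem[of "dtop D" "dneg D (dtop D)"]
    by (simp add: S_def bot_closed top_closed neg_closed)
  \<comment> \<open>\<open>dtop D\<close> itself need not be idempotent for meet, so its square
    serves as the top.\<close>
  have top: "dtop D \<sqinter> dtop D \<in> S"
    by (simp add: S_def top_closed meet_closed meet_meet_idem)
  have carrier: "carrier (meet_idempotents D) = S"
    by (simp add: meet_idempotents_def S_def)
  show ?thesis
  proof (unfold_locales; unfold carrier; simp add: meet_idempotents_def)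
    fix x y z assume xyz: "x \<in> S" "y \<in> S" "z \<in> S"
    show "(x \<sqinter> y) \<sqinter> z = x \<sqinter> (y \<sqinter> z)"
      using xyz S meet_assoc by simp
    show "(x \<curlyvee>\<^sub>d y) \<curlyvee>\<^sub>d z = x \<curlyvee>\<^sub>d (y \<curlyvee>\<^sub>d z)"
      using xyz S by (simp add: dvee_def neg meet nn meet_assoc neg_closed)
    show "x \<sqinter> (y \<curlyvee>\<^sub>d z) = (x \<sqinter> y) \<curlyvee>\<^sub>d (x \<sqinter> z)"
      using xyz S meet_vee_distrib by simp
    show "x \<curlyvee>\<^sub>d (y \<sqinter> z) = (x \<curlyvee>\<^sub>d y) \<sqinter> (x \<curlyvee>\<^sub>d z)"
      by (rule inj)
        (use xyz S meet_vee_distrib[of "dneg D x" "dneg D y" "dneg D z"] in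
          \<open>simp_all add: neg_vee neg_meet neg meet vee neg_closed\<close>)
  next
    fix x y assume xy: "x \<in> S" "y \<in> S"
    show "x \<sqinter> y = y \<sqinter> x"
      using xy S meet_commute by simp
    show "x \<curlyvee>\<^sub>d y = y \<curlyvee>\<^sub>d x"
      using xy S meet_commute[of "dneg D x" "dneg D y"] by (simp add: dvee_def neg_closed)
    show "x \<sqinter> (x \<curlyvee>\<^sub>d y) = x"
      using xy S meet_vee_absorb by simp
    show "x \<curlyvee>\<^sub>d (x \<sqinter> y) = x"
      by (rule inj)
        (use xy S in \<open>simp_all add: neg_vee neg_meet neg meet vee meet_vee_absorb neg_closed
          neg_meet_idem\<close>)
  next
    fix x assume x: "x \<in> S"
    show "x \<sqinter> dneg D x = dbot D"
      using x S meet_neg by simp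
    \<comment> \<open>Unfolded, the left side negates the meet of \<open>dneg D x\<close> with its
      own negation, that is, it negates \<open>dbot D\<close>.\<close>
    show "x \<curlyvee>\<^sub>d dneg D x = dtop D \<sqinter> dtop D"
      using x S neg_closed meet_neg[of "dneg D x"] by (simp add: dvee_def neg_bot)
  qed (use meet vee neg bot top in simp_all)
qed

end

section \<open>Recovering a double Boolean algebra from its idempotents\<close>

theorem double_boolean_algebra_representation:
  fixes D :: "'d dboolalg"
  assumes D: "double_boolean_algebra D"
  obtains P Q :: "'d boolalg" and r e r' e'
  where "retraction_data P Q (carrier D) r e r' e'"
    "commuting_condition (carrier D) r e r' e'"
    "absorption_condition P Q (carrier D) r e r' e'"
    "same_dboolalg D (dba_construction P Q (carrier D) r e r' e')"
proof
  let ?D' = "dual_dboolalg D"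
  \<comment> \<open>The join-idempotents of D are the meet-idempotents of its dual. There
    \<open>djoin D\<close> plays the part of meet, so a second dualization makes it the join of
    \<open>?Q\<close>. The identity serves as both inclusions.\<close>
  let ?P = "meet_idempotents D" and ?Q = "dual_boolalg (meet_idempotents ?D')"
    and ?r = "\<lambda>x. x \<sqinter>\<^bsub>D\<^esub> x" and ?r' = "\<lambda>x. x \<squnion>\<^bsub>D\<^esub> x" and ?e = "\<lambda>x :: 'd. x"
  note D' = double_boolean_algebra_dual[OF D]
  interpret double_boolean_algebra D by (fact D)
  have join_join_idem: "(x \<squnion>\<^bsub>D\<^esub> y) \<squnion>\<^bsub>D\<^esub> (x \<squnion>\<^bsub>D\<^esub> y) = x \<squnion>\<^bsub>D\<^esub> y"
    if "x \<in> carrier D" "y \<in> carrier D" for x y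
    using meet_meet_idem[OF D', of x y] that by simp
  \<comment> \<open>The constructed meet acts on squares, because \<open>?r\<close> squares its
    argument; this equation turns it back into the original meet.\<close>
  have meet_squares: "(x \<sqinter>\<^bsub>D\<^esub> x) \<sqinter>\<^bsub>D\<^esub> (y \<sqinter>\<^bsub>D\<^esub> y) = x \<sqinter>\<^bsub>D\<^esub> y"
    if "x \<in> carrier D" "y \<in> carrier D" for x y
    using that by (metis meet_closed meet_commute meet_idem_left)
  have join_squares: "(x \<squnion>\<^bsub>D\<^esub> x) \<squnion>\<^bsub>D\<^esub> (y \<squnion>\<^bsub>D\<^esub> y) = x \<squnion>\<^bsub>D\<^esub> y"
    if "x \<in> carrier D" "y \<in> carrier D" for x y
    using that by (metis join_closed join_commute join_idem_left)
  have ops: "carrier ?P = {x \<in> carrier D. x \<sqinter>\<^bsub>D\<^esub> x = x}" "bmeet ?P = dmeet D"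
    "bcompl ?P = dneg D" "bbot ?P = dbot D"
    "carrier ?Q = {x \<in> carrier D. x \<squnion>\<^bsub>D\<^esub> x = x}" "bjoin ?Q = djoin D"
    "bcompl ?Q = dopp D" "btop ?Q = dtop D"
    by (simp_all add: meet_idempotents_def dual_boolalg_def)
  show "retraction_data ?P ?Q (carrier D) ?r ?e ?r' ?e"
    using boolean_algebra_on_meet_idempotents[OF D]
      boolean_algebra_on_dual[OF boolean_algebra_on_meet_idempotents[OF D']]
    by (auto simp: retraction_data_def ops meet_closed join_closed join_join_idem
        meet_meet_idem[OF D])
  show "commuting_condition (carrier D) ?r ?e ?r' ?e"
    by (simp add: commuting_condition_def meet_join_idem)
  show "absorption_condition ?P ?Q (carrier D) ?r ?e ?r' ?e"
    by (simp add: absorption_condition_def ops meet_squares join_squares meet_closed join_closed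
        meet_join_absorb join_meet_absorb)
  show "same_dboolalg D (dba_construction ?P ?Q (carrier D) ?r ?e ?r' ?e)"
    by (simp add: same_dboolalg_def dba_construction_def ops meet_squares join_squares neg_idem
        opp_idem)
qed

text \<open>The existential Boolean algebras can have elements of type \<open>'d\<close> because
  both are carved out of the carrier of D.\<close>

theorem theorem4p1:
  fixes P :: "'p boolalg" and Q :: "'q boolalg" and A :: "'a set"
    and r :: "'a \<Rightarrow> 'p" and e :: "'p \<Rightarrow> 'a" and r' :: "'a \<Rightarrow> 'q" and e' :: "'q \<Rightarrow> 'a"
    and D :: "'d dboolalg"
  shows "(retraction_data P Q A r e r' e' \<longrightarrow>
            (double_boolean_algebra (dba_construction P Q A r e r' e') \<longleftrightarrow>
               commuting_condition A r e r' e' \<and> absorption_condition P Q A r e r' e')) \<and>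
         (double_boolean_algebra D \<longrightarrow>
            (\<exists>(P\<^sub>D :: 'd boolalg) (Q\<^sub>D :: 'd boolalg) r\<^sub>D e\<^sub>D r'\<^sub>D e'\<^sub>D.
               retraction_data P\<^sub>D Q\<^sub>D (carrier D) r\<^sub>D e\<^sub>D r'\<^sub>D e'\<^sub>D \<and>
               commuting_condition (carrier D) r\<^sub>D e\<^sub>D r'\<^sub>D e'\<^sub>D \<and>
               absorption_condition P\<^sub>D Q\<^sub>D (carrier D) r\<^sub>D e\<^sub>D r'\<^sub>D e'\<^sub>D \<and>
               same_dboolalg D (dba_construction P\<^sub>D Q\<^sub>D (carrier D) r\<^sub>D e\<^sub>D r'\<^sub>D e'\<^sub>D)))"
proof (intro conjI impI)
  assume "retraction_data P Q A r e r' e'"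
  then show "double_boolean_algebra (dba_construction P Q A r e r' e') \<longleftrightarrow>
      commuting_condition A r e r' e' \<and> absorption_condition P Q A r e r' e'"
    by (rule double_boolean_algebra_construction_iff)
next
  assume "double_boolean_algebra D"
  then show "\<exists>(P\<^sub>D :: 'd boolalg) (Q\<^sub>D :: 'd boolalg) r\<^sub>D e\<^sub>D r'\<^sub>D e'\<^sub>D.
      retraction_data P\<^sub>D Q\<^sub>D (carrier D) r\<^sub>D e\<^sub>D r'\<^sub>D e'\<^sub>D \<and>
      commuting_condition (carrier D) r\<^sub>D e\<^sub>D r'\<^sub>D e'\<^sub>D \<and>
      absorption_condition P\<^sub>D Q\<^sub>D (carrier D) r\<^sub>D e\<^sub>D r'\<^sub>D e'\<^sub>D \<and>
      same_dboolalg D (dba_construction P\<^sub>D Q\<^sub>D (carrier D) r\<^sub>D e\<^sub>D r'\<^sub>D e'\<^sub>D)"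
    by (elim double_boolean_algebra_representation) blast
qed

end
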